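(* Let $\mathbb{X},\mathbb{Y}$ be Euclidean spaces, $g:\mathbb{X}\to\mathbb{R}$ a continuous convex function, $\Phi:\mathbb{X}\to\mathbb{Y}$ a linear operator, and $y_0\in\mathbb{Y}$. Let $x_0$ be an optimal solution of the problem $$\min_{x\in\mathbb{X}}\ g(x)\quad\text{subject to}\quad\Phi x=y_0.$$ Then $$\operatorname{Ker}\Phi\cap\mathcal{D}_g(x_0)=\operatorname{Ker}\Phi\cap\mathcal{R}_{\partial g^*(y)}(x_0)\quad\text{for any}\quad y\in\Delta(x_0),$$ where $\Delta(x_0):=\partial g(x_0)\cap\operatorname{Im}\Phi^*$ is the set of dual certificates.
   Context: $\Phi^*$ is the adjoint of $\Phi$. The descent cone is $\mathcal{D}_g(x_0)=\operatorname{cone}\{x-x_0\mid g(x)\le g(x_0)\}$ (all nonnegative multiples). $\partial$ is the convex subdifferential; $g^*$ is the Legendre-Fenchel conjugate, with $\partial g^*(y)=\{x\in\mathbb{X}\mid y\in\partial g(x)\}$. For a closed convex set $\Omega$ and $x_0\in\Omega$, the radial cone is $\mathcal{R}_\Omega(x_0)=\mathbb{R}_+(\Omega-x_0)$. *)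

theory Defs
  imports "HOL-Analysis.Analysis"
begin

text \<open>
  The subdifferential is defined for extended-real-valued functions, because the conjugate of a
  real-valued function may take the value \<^term>\<open>\<infinity> :: ereal\<close>. As usual it is empty at points where
  the function is not finite. The inequality is written without subtraction, so that no
  \<open>\<infinity> - \<infinity>\<close> occurs.
\<close>

definition subdifferential :: "('a::real_inner \<Rightarrow> ereal) \<Rightarrow> 'a \<Rightarrow> 'a set" where
  "subdifferential f x = {v. \<bar>f x\<bar> \<noteq> \<infinity> \<and> (\<forall>z. f x + ereal (v \<bullet> (z - x)) \<le> f z)}"

definition fenchel_conjugate :: "('a::real_inner \<Rightarrow> ereal) \<Rightarrow> 'a \<Rightarrow> ereal" where
  "fenchel_conjugate f y = (SUP x. ereal (y \<bullet> x) - f x)"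

text \<open>\<open>cone hull S\<close> is the set of all nonnegative multiples of elements of \<open>S\<close>
  (\<open>cone_hull_expl\<close>); no convexification is involved.\<close>

definition descent_cone :: "('a::real_vector \<Rightarrow> real) \<Rightarrow> 'a \<Rightarrow> 'a set" where
  "descent_cone g x0 = cone hull {x - x0 | x. g x \<le> g x0}"

definition radial_cone :: "'a::real_vector set \<Rightarrow> 'a \<Rightarrow> 'a set" where
  "radial_cone \<Omega> x0 = {t *\<^sub>R (x - x0) | t x. 0 \<le> t \<and> x \<in> \<Omega>}"

definition dual_certificate_set ::
    "('a::euclidean_space \<Rightarrow> 'b::euclidean_space) \<Rightarrow> ('a \<Rightarrow> real) \<Rightarrow> 'a \<Rightarrow> 'a set" where
  "dual_certificate_set \<Phi> g x0 = subdifferential (\<lambda>x. ereal (g x)) x0 \<inter> range (adjoint \<Phi>)"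

end

theory Submission
  imports Defs
begin

text \<open>
  For a real-valued convex function \<open>g\<close>, the set \<open>\<partial>g\<^sup>*(y)\<close> consists of the points \<open>x\<close> with
  \<open>y \<in> \<partial>g(x)\<close> (lemma \<open>subdifferential_fenchel_conjugate_iff\<close>), that is, of the minimisers of
  \<open>g - \<langle>y, \<cdot>\<rangle>\<close>. A dual certificate \<open>y\<close> is orthogonal to \<open>Ker \<Phi>\<close>, so on the affine space
  \<open>x0 + Ker \<Phi>\<close> the functions \<open>g\<close> and \<open>g - \<langle>y, \<cdot>\<rangle>\<close> differ by a constant. Since \<open>x0\<close> minimises
  both of them on this affine space, a point \<open>x\<close> of it satisfies \<open>g x \<le> g x0\<close> exactly when it lies
  in \<open>\<partial>g\<^sup>*(y)\<close>: in both cases it attains the minimum. Both cones are therefore generated, inside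
  the kernel, by the same directions \<open>x - x0\<close>.

  Membership in \<open>\<partial>g\<^sup>*(y)\<close> yields \<open>y \<in> \<partial>g(x)\<close> only if \<open>g\<close> agrees with its biconjugate at \<open>x\<close>; this
  follows from the existence of a subgradient there (lemma \<open>convex_on_subgradient_exists\<close>).
\<close>

lemma subdifferential_ereal_iff:
  "v \<in> subdifferential (\<lambda>x. ereal (g x)) x \<longleftrightarrow> (\<forall>z. g x + v \<bullet> (z - x) \<le> g z)"
  by (simp add: subdifferential_def)

text \<open>
  Separating the graph point \<open>(x, g x)\<close> from the strict epigraph gives a hyperplane with normal
  \<open>(u, s)\<close>. Its last component \<open>s\<close> is nonnegative because the epigraph is unbounded upwards, and
  nonzero because \<open>g\<close> is finite everywhere: a vertical hyperplane would have the epigraph on both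
  sides. The slope \<open>- u / s\<close> is then a subgradient.
\<close>

lemma convex_on_subgradient_exists:
  fixes g :: "'a::euclidean_space \<Rightarrow> real"
  assumes "convex_on UNIV g"
  shows "\<exists>v. \<forall>z. g x + v \<bullet> (z - x) \<le> g z"
proof -
  define E where "E = {p :: 'a \<times> real. g (fst p) < snd p}"
  have "convex E"
    unfolding convex_def
  proof (intro ballI allI impI)
    fix p q :: "'a \<times> real" and a b :: real
    assume pq: "p \<in> E" "q \<in> E" and ab: "0 \<le> a" "0 \<le> b" "a + b = 1"
    have "g (a *\<^sub>R fst p + b *\<^sub>R fst q) \<le> a * g (fst p) + b * g (fst q)"
      using assms ab by (auto simp: convex_on_def)
    also have "\<dots> < a * snd p + b * snd q"
    proof (cases "a = 0")
      case True
      then show ?thesis using pq ab by (simp add: E_def)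
    next
      case False
      then have "a * g (fst p) < a * snd p" using pq ab by (simp add: E_def)
      moreover have "b * g (fst q) \<le> b * snd q"
        using pq ab by (intro mult_left_mono) (auto simp: E_def)
      ultimately show ?thesis by linarith
    qed
    finally show "a *\<^sub>R p + b *\<^sub>R q \<in> E" by (simp add: E_def)
  qed
  moreover have "(x, g x + 1) \<in> E" "{(x, g x)} \<inter> E = {}"
    by (simp_all add: E_def)
  ultimately have "\<exists>n b. n \<noteq> 0 \<and> (\<forall>p\<in>{(x, g x)}. n \<bullet> p \<le> b) \<and> (\<forall>p\<in>E. b \<le> n \<bullet> p)"
    by (intro separating_hyperplane_sets) auto
  then obtain n :: "'a \<times> real" and b where n: "n \<noteq> 0"
    and le: "n \<bullet> (x, g x) \<le> b" and ge: "\<And>p. p \<in> E \<Longrightarrow> b \<le> n \<bullet> p"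
    by blast
  obtain u s where us: "n = (u, s)" by (cases n)
  have sep: "u \<bullet> x + s * g x \<le> u \<bullet> z + s * t" if "g z < t" for z t
    using le ge[of "(z, t)"] that by (simp add: E_def us)
  have "0 \<le> s"
    using sep[of x "g x + 1"] by (simp add: algebra_simps)
  moreover have "s \<noteq> 0"
  proof
    assume "s = 0"
    \<comment> \<open>Moving from \<open>x\<close> in the direction \<open>- u\<close> would cross the vertical hyperplane.\<close>
    with sep[of "x - u" "g (x - u) + 1"] have "u \<bullet> u \<le> 0"
      by (simp add: inner_diff_right)
    then have "u = 0"
      using inner_gt_zero_iff[of u] by linarith
    with n us \<open>s = 0\<close> show False by (simp add: zero_prod_def)
  qed
  ultimately have "0 < s" by simp
  have "g x + ((- 1 / s) *\<^sub>R u) \<bullet> (z - x) \<le> g z" for z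
  proof (rule field_le_epsilon)
    fix e :: real
    assume "0 < e"
    then have "u \<bullet> x + s * g x \<le> u \<bullet> z + s * (g z + e)"
      by (intro sep) simp
    then show "g x + ((- 1 / s) *\<^sub>R u) \<bullet> (z - x) \<le> g z + e"
      using \<open>0 < s\<close> by (simp add: field_simps inner_diff_right)
  qed
  then show ?thesis by blast
qed

text \<open>
  The supremum in \<open>g\<^sup>*(y)\<close> is attained wherever \<open>y\<close> is a subgradient: the case of equality in the
  Fenchel--Young inequality.
\<close>

lemma fenchel_conjugate_at_subgradient:
  assumes "\<forall>z. g x + y \<bullet> (z - x) \<le> g z"
  shows "fenchel_conjugate (\<lambda>x. ereal (g x)) y = ereal (y \<bullet> x - g x)"
  unfolding fenchel_conjugate_def
proof (rule SUP_eqI)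
  show "ereal (y \<bullet> z) - ereal (g z) \<le> ereal (y \<bullet> x - g x)" for z
    using assms[rule_format, of z] by (simp add: inner_diff_right)
next
  fix c
  assume "\<And>z. z \<in> UNIV \<Longrightarrow> ereal (y \<bullet> z) - ereal (g z) \<le> c"
  from this[of x] show "ereal (y \<bullet> x - g x) \<le> c" by simp
qed

lemma fenchel_young:
  "ereal (y \<bullet> x - g x) \<le> fenchel_conjugate (\<lambda>x. ereal (g x)) y"
  unfolding fenchel_conjugate_def by (rule SUP_upper2[of x]) simp_all

text \<open>
  If \<open>x \<in> \<partial>g\<^sup>*(y)\<close>, the subgradient inequality of \<open>g\<^sup>*\<close> is tested at a subgradient \<open>v\<close> of \<open>g\<close> at
  \<open>x\<close>, where \<open>g\<^sup>*(v)\<close> is known. This bounds \<open>g\<^sup>*(y)\<close> by \<open>\<langle>y, x\<rangle> - g x\<close>, which says that \<open>y\<close> is a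
  subgradient of \<open>g\<close> at \<open>x\<close>. Conversely, equality in the Fenchel--Young inequality for \<open>(x, y)\<close>,
  combined with the inequality for \<open>(x, w)\<close>, is the subgradient inequality of \<open>g\<^sup>*\<close>.
\<close>

lemma subdifferential_fenchel_conjugate_iff:
  fixes g :: "'a::euclidean_space \<Rightarrow> real"
  assumes "convex_on UNIV g"
  shows "x \<in> subdifferential (fenchel_conjugate (\<lambda>x. ereal (g x))) y \<longleftrightarrow>
    y \<in> subdifferential (\<lambda>x. ereal (g x)) x"
    (is "x \<in> subdifferential ?h y \<longleftrightarrow> _")
proof
  assume x: "x \<in> subdifferential ?h y"
  obtain v where v: "\<forall>z. g x + v \<bullet> (z - x) \<le> g z"
    using convex_on_subgradient_exists[OF assms] by blast
  from x have fin: "\<bar>?h y\<bar> \<noteq> \<infinity>" and "?h y + ereal (x \<bullet> (v - y)) \<le> ?h v"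
    by (auto simp: subdifferential_def)
  moreover obtain r where r: "?h y = ereal r" using fin by auto
  ultimately have r_le: "r \<le> y \<bullet> x - g x"
    by (simp add: fenchel_conjugate_at_subgradient[of g, OF v] inner_diff_right inner_commute)
  have "g x + y \<bullet> (z - x) \<le> g z" for z
    using fenchel_young[of y z g] r_le by (simp add: r inner_diff_right)
  then show "y \<in> subdifferential (\<lambda>x. ereal (g x)) x"
    by (simp add: subdifferential_ereal_iff)
next
  assume "y \<in> subdifferential (\<lambda>x. ereal (g x)) x"
  then have hy: "?h y = ereal (y \<bullet> x - g x)"
    by (intro fenchel_conjugate_at_subgradient) (simp add: subdifferential_ereal_iff)
  have "?h y + ereal (x \<bullet> (w - y)) \<le> ?h w" for w
    using fenchel_young[of w x g] by (simp add: hy inner_diff_right inner_commute)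
  then show "x \<in> subdifferential ?h y"
    by (simp add: subdifferential_def hy)
qed

theorem proposition4p4:
  fixes g :: "'a::euclidean_space \<Rightarrow> real"
    and \<Phi> :: "'a \<Rightarrow> 'b::euclidean_space"
    and y0 :: 'b and x0 :: 'a
  assumes "continuous_on UNIV g"
    and "convex_on UNIV g"
    and "linear \<Phi>"
    and "is_arg_min g (\<lambda>x. \<Phi> x = y0) x0"
  shows "\<forall>y \<in> dual_certificate_set \<Phi> g x0.
    {x. \<Phi> x = 0} \<inter> descent_cone g x0 =
    {x. \<Phi> x = 0} \<inter>
      radial_cone (subdifferential (fenchel_conjugate (\<lambda>x. ereal (g x))) y) x0"
proof
  fix y
  assume y: "y \<in> dual_certificate_set \<Phi> g x0"
  let ?S = "subdifferential (fenchel_conjugate (\<lambda>x. ereal (g x))) y"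
  have S_iff: "x \<in> ?S \<longleftrightarrow> (\<forall>z. g x + y \<bullet> (z - x) \<le> g z)" for x
    using subdifferential_fenchel_conjugate_iff[OF assms(2)] subdifferential_ereal_iff by blast
  from y have sub: "\<forall>z. g x0 + y \<bullet> (z - x0) \<le> g z"
    by (simp add: dual_certificate_set_def subdifferential_ereal_iff)
  from y obtain w where w: "y = adjoint \<Phi> w"
    by (auto simp: dual_certificate_set_def)
  have y_ker: "y \<bullet> d = 0" if "\<Phi> d = 0" for d
    using adjoint_works[OF assms(3), of d w] that by (simp add: w inner_commute)
  have key: "g x \<le> g x0 \<longleftrightarrow> x \<in> ?S" if ker: "\<Phi> (x - x0) = 0" for x
  proof
    assume "g x \<le> g x0"
    moreover have "\<Phi> x = y0"
      using ker assms(3,4) by (simp add: linear_diff is_arg_min_def)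
    then have "g x0 \<le> g x"
      using assms(4) by (force simp: is_arg_min_def)
    ultimately have "g x = g x0" by simp
    moreover have "y \<bullet> x = y \<bullet> x0"
      using y_ker[OF ker] by (simp add: inner_diff_right)
    ultimately show "x \<in> ?S"
      using sub by (simp add: S_iff inner_diff_right)
  next
    assume "x \<in> ?S"
    then have "g x + y \<bullet> (x0 - x) \<le> g x0" by (simp add: S_iff)
    then show "g x \<le> g x0"
      using y_ker[OF ker] by (simp add: inner_diff_right)
  qed
  have descent_cone_iff:
    "d \<in> descent_cone g x0 \<longleftrightarrow> (\<exists>t x. d = t *\<^sub>R (x - x0) \<and> 0 \<le> t \<and> g x \<le> g x0)" for d
    by (auto simp: descent_cone_def cone_hull_expl)
  have radial_cone_iff:
    "d \<in> radial_cone ?S x0 \<longleftrightarrow> (\<exists>t x. d = t *\<^sub>R (x - x0) \<and> 0 \<le> t \<and> x \<in> ?S)" for d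
    by (auto simp: radial_cone_def)
  \<comment> \<open>For \<open>t = 0\<close> the generating point \<open>x\<close> need not lie in \<open>x0 + Ker \<Phi>\<close>; it is replaced by \<open>x0\<close>,
    which belongs to both generating sets.\<close>
  have generators: "(\<exists>t x. d = t *\<^sub>R (x - x0) \<and> 0 \<le> t \<and> x \<in> A) \<longleftrightarrow>
      (\<exists>t x. d = t *\<^sub>R (x - x0) \<and> 0 \<le> t \<and> x \<in> A \<and> \<Phi> (x - x0) = 0)"
    if "\<Phi> d = 0" "x0 \<in> A" for d A
  proof
    assume "\<exists>t x. d = t *\<^sub>R (x - x0) \<and> 0 \<le> t \<and> x \<in> A"
    then obtain t x where tx: "d = t *\<^sub>R (x - x0)" "0 \<le> t" "x \<in> A" by blast
    show "\<exists>t x. d = t *\<^sub>R (x - x0) \<and> 0 \<le> t \<and> x \<in> A \<and> \<Phi> (x - x0) = 0"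
    proof (cases "t = 0")
      case True
      then have "d = 0 *\<^sub>R (x0 - x0)" "\<Phi> (x0 - x0) = 0"
        using tx assms(3) by (simp_all add: linear_0)
      then show ?thesis using that(2) by blast
    next
      case False
      have "t *\<^sub>R \<Phi> (x - x0) = 0"
        using that(1) tx(1) linear_cmul[OF assms(3)] by metis
      then show ?thesis using False tx by auto
    qed
  qed blast
  have "x0 \<in> ?S" using sub by (simp add: S_iff)
  then have "d \<in> descent_cone g x0 \<longleftrightarrow> d \<in> radial_cone ?S x0" if "\<Phi> d = 0" for d
    using generators[OF that, of "{x. g x \<le> g x0}"] generators[OF that, of ?S] key
    unfolding descent_cone_iff radial_cone_iff by auto
  then show "{x. \<Phi> x = 0} \<inter> descent_cone g x0 = {x. \<Phi> x = 0} \<inter> radial_cone ?S x0"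
    by auto
qed

end
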